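(* Let $n\ge 3$, and let the group algebra $\mathbb{Q}\mathfrak{S}_n$ of the symmetric group $\mathfrak{S}_n$ act on $\mathbb{Q}[x_1,\dots,x_n,y_1,\dots,y_n]$ by the diagonal Hivert action $*$, i.e. the linear action determined on monomials by $\sigma * (\mathbf{x}\mathbf{y})_{\mathbf i}^{\mathfrak a} = (\mathbf{x}\mathbf{y})_{\sigma\cdot\mathbf i}^{\mathfrak a}$. Then the kernel $\mathrm{Ker}_n\subseteq \mathbb{Q}\mathfrak{S}_n$ of this action (the set of elements of $\mathbb{Q}\mathfrak{S}_n$ acting as zero) is the two-sided ideal of $\mathbb{Q}\mathfrak{S}_n$ generated by the element $$E_{\{1,2,3\}} = 1\,2\,3\,4\cdots n - 1\,3\,2\,4\cdots n - 2\,1\,3\,4\cdots n + 2\,3\,1\,4\cdots n + 3\,1\,2\,4\cdots n - 3\,2\,1\,4\cdots n,$$ where permutations are written in one-line notation. Thus $\mathrm{TL}_n\simeq \mathbb{Q}\mathfrak{S}_n/\mathrm{Ker}_n$, and $\mathrm{TL}_n$ acts faithfully on $\mathbb{Q}[x_1,\dots,x_n,y_1,\dots,y_n]$.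
   Context: Notation for monomials. A bicomposition of length $k$ is a sequence $\mathfrak a=(\alpha_1,\dots,\alpha_k)$ of nonzero vectors $\alpha_m=(a_m,b_m)\in\mathbb{N}\times\mathbb{N}$ (where $0\in\mathbb N$); there is one empty bicomposition, of length $0$. For a subset $\mathbf i=\{i_1<i_2<\dots<i_k\}$ of $\{1,\dots,n\}$ and a bicomposition $\mathfrak a$ of length $k=|\mathbf i|$, set $$(\mathbf{x}\mathbf{y})_{\mathbf i}^{\mathfrak a} := (x_{i_1}^{a_1}y_{i_1}^{b_1})(x_{i_2}^{a_2}y_{i_2}^{b_2})\cdots(x_{i_k}^{a_k}y_{i_k}^{b_k}).$$ Every monomial in $\mathbb{Q}[x_1,\dots,x_n,y_1,\dots,y_n]$ is uniquely of this form (the monomial $1$ corresponds to $\mathbf i=\emptyset$). Action. For $\sigma\in\mathfrak{S}_n$, $\sigma\cdot\mathbf i:=\{\sigma(i)\mid i\in\mathbf i\}$, and $\sigma * (\mathbf{x}\mathbf{y})_{\mathbf i}^{\mathfrak a} := (\mathbf{x}\mathbf{y})_{\sigma\cdot\mathbf i}^{\mathfrak a}$, where the elements of $\sigma\cdot\mathbf i$ are re-listed in increasing order before the exponents $\alpha_1,\dots,\alpha_k$ are attached in order. This is extended linearly to $\mathbb{Q}\mathfrak{S}_n$ and to all polynomials. (It does not preserve the multiplication of polynomials.) Temperley-Lieb algebra. $\mathrm{TL}_n(q)$ is the quotient of the Hecke algebra of $\mathfrak{S}_n$, with standard generators $T_1,\dots,T_{n-1}$, by the relations $e_ie_{i\pm1}e_i=\frac{q}{(1+q)^2}e_i$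 whenever the indices $i, i\pm 1$ lie in $\{1,\dots,n-1\}$, where $e_i:=(q-T_i)/(1+q)$. Here $\mathrm{TL}_n$ denotes the specialization at $q=1$: the quotient of the $\mathbb{Q}$-algebra $\mathbb{Q}\mathfrak{S}_n$ by the relations $e_ie_{i\pm1}e_i=\frac14 e_i$, where $e_i=\frac12(1-s_i)$ and $s_i$ is the transposition $(i,\,i+1)$. *)

theory Defs
  imports
    Complex_Main
    "HOL-Algebra.Sym_Groups"
    "HOL-Algebra.QuotRing"
    "HOL-Algebra.Module"
    "HOL-Library.Poly_Mapping"
begin

section \<open>Free rational vector spaces\<close>

definition scal :: "rat \<Rightarrow> ('a \<Rightarrow>\<^sub>0 rat) \<Rightarrow> ('a \<Rightarrow>\<^sub>0 rat)" where
  "scal c f = Poly_Mapping.map ((*) c) f"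

text \<open>The bilinear map that sends a pair of basis elements \<open>(s, t)\<close> to the basis element \<open>h s t\<close>.\<close>

definition bilin :: "('a \<Rightarrow> 'b \<Rightarrow> 'c) \<Rightarrow> ('a \<Rightarrow>\<^sub>0 rat) \<Rightarrow> ('b \<Rightarrow>\<^sub>0 rat) \<Rightarrow> ('c \<Rightarrow>\<^sub>0 rat)" where
  "bilin h a b = (\<Sum>s\<in>Poly_Mapping.keys a. \<Sum>t\<in>Poly_Mapping.keys b.
      Poly_Mapping.single (h s t) (Poly_Mapping.lookup a s * Poly_Mapping.lookup b t))"


section \<open>Rational algebras, quotients, and actions\<close>

text \<open>
  A rational algebra is a \<^typ>\<open>(rat, 'a) module\<close> record (a ring record with a scalar
  multiplication); the library locale \<open>algebra\<close> covers commutative algebras only.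
\<close>

definition quot_algebra :: "(rat, 'a, 'm) module_scheme \<Rightarrow> 'a set \<Rightarrow> (rat, 'a set) module" where
  "quot_algebra A I =
    \<lparr>carrier = carrier (A Quot I), mult = mult (A Quot I), one = one (A Quot I),
     zero = zero (A Quot I), add = add (A Quot I),
     smult = (\<lambda>c X. \<Union>x\<in>X. I +>\<^bsub>A\<^esub> (c \<odot>\<^bsub>A\<^esub> x))\<rparr>"

definition algebra_iso ::
    "(rat, 'a, 'm) module_scheme \<Rightarrow> (rat, 'b, 'k) module_scheme \<Rightarrow> ('a \<Rightarrow> 'b) set" where
  "algebra_iso A B = {\<phi> \<in> ring_iso A B.
     \<forall>c. \<forall>x\<in>carrier A. \<phi> (c \<odot>\<^bsub>A\<^esub> x) = c \<odot>\<^bsub>B\<^esub> \<phi> x}"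

text \<open>\<open>\<rho>\<close> makes the subspace \<open>V\<close> a unital left module over the algebra \<open>A\<close>.\<close>

definition algebra_action ::
    "(rat, 'a, 'm) module_scheme \<Rightarrow> ('v \<Rightarrow>\<^sub>0 rat) set
      \<Rightarrow> ('a \<Rightarrow> ('v \<Rightarrow>\<^sub>0 rat) \<Rightarrow> ('v \<Rightarrow>\<^sub>0 rat)) \<Rightarrow> bool" where
  "algebra_action A V \<rho> \<longleftrightarrow>
    (\<forall>a\<in>carrier A. \<forall>f\<in>V. \<rho> a f \<in> V) \<and>
    (\<forall>a\<in>carrier A. \<forall>f\<in>V. \<forall>g\<in>V. \<rho> a (f + g) = \<rho> a f + \<rho> a g) \<and>
    (\<forall>a\<in>carrier A. \<forall>c. \<forall>f\<in>V. \<rho> a (scal c f) = scal c (\<rho> a f)) \<and>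
    (\<forall>a\<in>carrier A. \<forall>b\<in>carrier A. \<forall>f\<in>V. \<rho> (a \<oplus>\<^bsub>A\<^esub> b) f = \<rho> a f + \<rho> b f) \<and>
    (\<forall>c. \<forall>a\<in>carrier A. \<forall>f\<in>V. \<rho> (c \<odot>\<^bsub>A\<^esub> a) f = scal c (\<rho> a f)) \<and>
    (\<forall>f\<in>V. \<rho> \<one>\<^bsub>A\<^esub> f = f) \<and>
    (\<forall>a\<in>carrier A. \<forall>b\<in>carrier A. \<forall>f\<in>V. \<rho> (a \<otimes>\<^bsub>A\<^esub> b) f = \<rho> a (\<rho> b f))"

definition action_kernel ::
    "(rat, 'a, 'm) module_scheme \<Rightarrow> ('v \<Rightarrow>\<^sub>0 rat) set
      \<Rightarrow> ('a \<Rightarrow> ('v \<Rightarrow>\<^sub>0 rat) \<Rightarrow> ('v \<Rightarrow>\<^sub>0 rat)) \<Rightarrow> 'a set" where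
  "action_kernel A V \<rho> = {a \<in> carrier A. \<forall>f\<in>V. \<rho> a f = 0}"

definition faithful_action ::
    "(rat, 'a, 'm) module_scheme \<Rightarrow> ('v \<Rightarrow>\<^sub>0 rat) set
      \<Rightarrow> ('a \<Rightarrow> ('v \<Rightarrow>\<^sub>0 rat) \<Rightarrow> ('v \<Rightarrow>\<^sub>0 rat)) \<Rightarrow> bool" where
  "faithful_action A V \<rho> \<longleftrightarrow> algebra_action A V \<rho> \<and> action_kernel A V \<rho> = {\<zero>\<^bsub>A\<^esub>}"


section \<open>The group algebra and the Temperley--Lieb algebra\<close>

definition group_algebra :: "('g, 'm) monoid_scheme \<Rightarrow> (rat, 'g \<Rightarrow>\<^sub>0 rat) module" where
  "group_algebra G =
    \<lparr>carrier = {a. Poly_Mapping.keys a \<subseteq> carrier G},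
     mult = bilin (mult G), one = Poly_Mapping.single \<one>\<^bsub>G\<^esub> 1,
     zero = 0, add = (+), smult = scal\<rparr>"

text \<open>In \<^const>\<open>sym_group\<close> the product \<open>\<sigma>\<tau>\<close> is \<open>\<sigma> \<circ> \<tau>\<close>.\<close>

definition QS :: "nat \<Rightarrow> (rat, (nat \<Rightarrow> nat) \<Rightarrow>\<^sub>0 rat) module" where
  "QS n = group_algebra (sym_group n)"

definition perm_elt :: "(nat \<Rightarrow> nat) \<Rightarrow> ((nat \<Rightarrow> nat) \<Rightarrow>\<^sub>0 rat)" where
  "perm_elt \<sigma> = Poly_Mapping.single \<sigma> 1"

text \<open>One-line notation; a word of length \<open>k\<close> is continued by \<open>k+1, k+2, \<dots>\<close>.\<close>

definition one_line :: "nat list \<Rightarrow> nat \<Rightarrow> nat" where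
  "one_line w j = (if 1 \<le> j \<and> j \<le> length w then w ! (j - 1) else j)"

definition E123 :: "(nat \<Rightarrow> nat) \<Rightarrow>\<^sub>0 rat" where
  "E123 = perm_elt (one_line [1,2,3]) - perm_elt (one_line [1,3,2])
        - perm_elt (one_line [2,1,3]) + perm_elt (one_line [2,3,1])
        + perm_elt (one_line [3,1,2]) - perm_elt (one_line [3,2,1])"

definition TL_e :: "nat \<Rightarrow> ((nat \<Rightarrow> nat) \<Rightarrow>\<^sub>0 rat)" where
  "TL_e i = scal (1/2) (perm_elt id - perm_elt (transpose i (i + 1)))"

definition TL_relators :: "nat \<Rightarrow> ((nat \<Rightarrow> nat) \<Rightarrow>\<^sub>0 rat) set" where
  "TL_relators n =
    {TL_e i \<otimes>\<^bsub>QS n\<^esub> TL_e j \<otimes>\<^bsub>QS n\<^esub> TL_e i - scal (1/4) (TL_e i) | i j.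
       i \<in> {1..n-1} \<and> j \<in> {1..n-1} \<and> (j = i + 1 \<or> i = j + 1)}"

definition TL_ideal :: "nat \<Rightarrow> ((nat \<Rightarrow> nat) \<Rightarrow>\<^sub>0 rat) set" where
  "TL_ideal n = Idl\<^bsub>QS n\<^esub> (TL_relators n)"

definition TL :: "nat \<Rightarrow> (rat, ((nat \<Rightarrow> nat) \<Rightarrow>\<^sub>0 rat) set) module" where
  "TL n = quot_algebra (QS n) (TL_ideal n)"


section \<open>Polynomials and the diagonal Hivert action\<close>

datatype var = X nat | Y nat

type_synonym monomial = "var \<Rightarrow>\<^sub>0 nat"
type_synonym polynomial = "monomial \<Rightarrow>\<^sub>0 rat"

definition polys :: "nat \<Rightarrow> polynomial set" where
  "polys n = {f. \<forall>m\<in>Poly_Mapping.keys f. Poly_Mapping.keys m \<subseteq> X ` {1..n} \<union> Y ` {1..n}}"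

definition bicomposition :: "(nat \<times> nat) list \<Rightarrow> bool" where
  "bicomposition \<aa> \<longleftrightarrow> (0, 0) \<notin> set \<aa>"

text \<open>
  The exponent vector of \<open>(\<^bold>x\<^bold>y)\<^sub>I\<^sup>\<aa>\<close>: monomials are written additively, and
  \<^const>\<open>sorted_list_of_set\<close> lists \<open>I\<close> increasingly.
\<close>

definition xy :: "nat set \<Rightarrow> (nat \<times> nat) list \<Rightarrow> monomial" where
  "xy I \<aa> = (\<Sum>k<length \<aa>.
      Poly_Mapping.single (X (sorted_list_of_set I ! k)) (fst (\<aa> ! k))
    + Poly_Mapping.single (Y (sorted_list_of_set I ! k)) (snd (\<aa> ! k)))"

definition mono_set :: "monomial \<Rightarrow> nat set" where
  "mono_set m = {i. Poly_Mapping.lookup m (X i) \<noteq> 0 \<or> Poly_Mapping.lookup m (Y i) \<noteq> 0}"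

definition mono_bicomp :: "monomial \<Rightarrow> (nat \<times> nat) list" where
  "mono_bicomp m = map (\<lambda>i. (Poly_Mapping.lookup m (X i), Poly_Mapping.lookup m (Y i)))
     (sorted_list_of_set (mono_set m))"

text \<open>
  \<^const>\<open>mono_set\<close> and \<^const>\<open>mono_bicomp\<close> recover the unique \<open>I\<close> and \<open>\<aa>\<close> with
  \<open>m = (\<^bold>x\<^bold>y)\<^sub>I\<^sup>\<aa>\<close>; see \<open>mono_set_xy\<close>, \<open>mono_bicomp_xy\<close> and
  \<open>xy_mono_set_mono_bicomp\<close> below.
\<close>

definition hivert_mono :: "(nat \<Rightarrow> nat) \<Rightarrow> monomial \<Rightarrow> monomial" where
  "hivert_mono \<sigma> m = xy (\<sigma> ` mono_set m) (mono_bicomp m)"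

definition hivert :: "((nat \<Rightarrow> nat) \<Rightarrow>\<^sub>0 rat) \<Rightarrow> polynomial \<Rightarrow> polynomial" where
  "hivert = bilin hivert_mono"

definition Ker :: "nat \<Rightarrow> ((nat \<Rightarrow> nat) \<Rightarrow>\<^sub>0 rat) set" where
  "Ker n = action_kernel (QS n) (polys n) hivert"


section \<open>Basic properties\<close>

lemma lookup_scal [simp]: "Poly_Mapping.lookup (scal c f) k = c * Poly_Mapping.lookup f k"
  by (simp add: scal_def Poly_Mapping.map.rep_eq when_def)

lemma keys_scal: "Poly_Mapping.keys (scal c f) \<subseteq> Poly_Mapping.keys f"
  by (auto simp: in_keys_iff)

lemma scal_add: "scal c (f + g) = scal c f + scal c g"
  by (rule poly_mapping_eqI) (simp add: lookup_add algebra_simps)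

lemma scal_sum: "scal c (\<Sum>i\<in>A. f i) = (\<Sum>i\<in>A. scal c (f i))"
  by (rule poly_mapping_eqI) (simp add: lookup_sum sum_distrib_left)

lemma scal_single: "scal c (Poly_Mapping.single k v) = Poly_Mapping.single k (c * v)"
  by (rule poly_mapping_eqI) (simp add: lookup_single when_def)

lemma bilin_superset:
  assumes "finite S" "finite T" "Poly_Mapping.keys a \<subseteq> S" "Poly_Mapping.keys b \<subseteq> T"
  shows "bilin h a b = (\<Sum>s\<in>S. \<Sum>t\<in>T.
    Poly_Mapping.single (h s t) (Poly_Mapping.lookup a s * Poly_Mapping.lookup b t))"
proof -
  have "bilin h a b = (\<Sum>s\<in>Poly_Mapping.keys a. \<Sum>t\<in>T.
    Poly_Mapping.single (h s t) (Poly_Mapping.lookup a s * Poly_Mapping.lookup b t))"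
    unfolding bilin_def using assms
    by (intro sum.cong refl sum.mono_neutral_left) (auto simp: in_keys_iff)
  also have "\<dots> = (\<Sum>s\<in>S. \<Sum>t\<in>T.
    Poly_Mapping.single (h s t) (Poly_Mapping.lookup a s * Poly_Mapping.lookup b t))"
    using assms by (intro sum.mono_neutral_left) (auto simp: in_keys_iff)
  finally show ?thesis .
qed

lemma bilin_add_left: "bilin h (a + a') b = bilin h a b + bilin h a' b"
proof -
  let ?S = "Poly_Mapping.keys a \<union> Poly_Mapping.keys a'"
  note B = bilin_superset[of ?S "Poly_Mapping.keys b" _ b h]
  show ?thesis
    using Poly_Mapping.keys_add[of a a']
    by (simp add: B lookup_add distrib_right single_add sum.distrib)
qed

lemma bilin_add_right: "bilin h a (b + b') = bilin h a b + bilin h a b'"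
proof -
  let ?T = "Poly_Mapping.keys b \<union> Poly_Mapping.keys b'"
  note B = bilin_superset[of "Poly_Mapping.keys a" ?T a _ h]
  show ?thesis
    using Poly_Mapping.keys_add[of b b']
    by (simp add: B lookup_add distrib_left single_add sum.distrib)
qed

lemma bilin_scal_left: "bilin h (scal c a) b = scal c (bilin h a b)"
  unfolding bilin_superset[OF finite_keys finite_keys keys_scal order_refl, of h c a b]
  by (simp add: bilin_def scal_sum scal_single mult.assoc)

lemma bilin_scal_right: "bilin h a (scal c b) = scal c (bilin h a b)"
  unfolding bilin_superset[OF finite_keys finite_keys order_refl keys_scal, of h a c b]
  by (simp add: bilin_def scal_sum scal_single mult.left_commute)

lemma bilin_zero [simp]: "bilin h 0 b = 0" "bilin h a 0 = 0"
  by (simp_all add: bilin_def)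

lemma bilin_sum_left: "bilin h (\<Sum>i\<in>A. f i) b = (\<Sum>i\<in>A. bilin h (f i) b)"
  by (induction A rule: infinite_finite_induct) (auto simp: bilin_add_left)

lemma bilin_sum_right: "bilin h a (\<Sum>i\<in>A. f i) = (\<Sum>i\<in>A. bilin h a (f i))"
  by (induction A rule: infinite_finite_induct) (auto simp: bilin_add_right)

lemma bilin_single:
  "bilin h (Poly_Mapping.single s u) (Poly_Mapping.single t v) = Poly_Mapping.single (h s t) (u * v)"
  by (simp add: bilin_superset[of "{s}" "{t}"])

lemma sum_single: "(\<Sum>s\<in>Poly_Mapping.keys a. Poly_Mapping.single s (Poly_Mapping.lookup a s)) = a"
  by (rule poly_mapping_eqI) (simp add: lookup_sum lookup_single when_def in_keys_iff)

lemma bilin_assoc: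
  assumes "\<And>s t u. s \<in> Poly_Mapping.keys a \<Longrightarrow> t \<in> Poly_Mapping.keys b \<Longrightarrow>
             u \<in> Poly_Mapping.keys c \<Longrightarrow> h (k s t) u = h' s (k' t u)"
  shows "bilin h (bilin k a b) c = bilin h' a (bilin k' b c)"
proof -
  have "bilin h (bilin k a b) c
      = (\<Sum>s\<in>Poly_Mapping.keys a. \<Sum>t\<in>Poly_Mapping.keys b. \<Sum>u\<in>Poly_Mapping.keys c.
          Poly_Mapping.single (h (k s t) u)
            (Poly_Mapping.lookup a s * Poly_Mapping.lookup b t * Poly_Mapping.lookup c u))"
    by (subst sum_single[of c, symmetric], subst bilin_def[of k])
       (simp only: bilin_sum_left, simp only: bilin_sum_right bilin_single)
  moreover have "bilin h' a (bilin k' b c)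
      = (\<Sum>s\<in>Poly_Mapping.keys a. \<Sum>t\<in>Poly_Mapping.keys b. \<Sum>u\<in>Poly_Mapping.keys c.
          Poly_Mapping.single (h' s (k' t u))
            (Poly_Mapping.lookup a s * Poly_Mapping.lookup b t * Poly_Mapping.lookup c u))"
    by (subst sum_single[of a, symmetric], subst bilin_def[of k'])
       (simp only: bilin_sum_left, simp only: bilin_sum_right bilin_single mult.assoc)
  ultimately show ?thesis
    using assms by (simp cong: sum.cong)
qed

lemma keys_bilin: "Poly_Mapping.keys (bilin h a b)
    \<subseteq> (\<lambda>(s, t). h s t) ` (Poly_Mapping.keys a \<times> Poly_Mapping.keys b)"
proof -
  have "k \<in> (\<lambda>(s, t). h s t) ` (Poly_Mapping.keys a \<times> Poly_Mapping.keys b)"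
    if "Poly_Mapping.lookup (bilin h a b) k \<noteq> 0" for k
  proof -
    have "\<exists>s\<in>Poly_Mapping.keys a. \<exists>t\<in>Poly_Mapping.keys b. h s t = k"
    proof (rule ccontr)
      assume "\<not> ?thesis"
      then have "Poly_Mapping.lookup (bilin h a b) k = 0"
        by (auto simp: bilin_def lookup_sum lookup_single when_def intro!: sum.neutral)
      with that show False by simp
    qed
    then show ?thesis by force
  qed
  then show ?thesis by (auto simp: in_keys_iff)
qed

lemma bilin_unit_left:
  assumes "\<And>t. t \<in> Poly_Mapping.keys b \<Longrightarrow> h s t = t"
  shows "bilin h (Poly_Mapping.single s 1) b = b"
proof -
  have "bilin h (Poly_Mapping.single s 1) b
      = (\<Sum>t\<in>Poly_Mapping.keys b. Poly_Mapping.single t (Poly_Mapping.lookup b t))"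
    using assms by (simp add: bilin_def)
  then show ?thesis by (simp add: sum_single)
qed

lemma bilin_unit_right:
  assumes "\<And>s. s \<in> Poly_Mapping.keys a \<Longrightarrow> h s t = s"
  shows "bilin h a (Poly_Mapping.single t 1) = a"
proof -
  have "bilin h a (Poly_Mapping.single t 1)
      = (\<Sum>s\<in>Poly_Mapping.keys a. Poly_Mapping.single s (Poly_Mapping.lookup a s))"
    using assms by (simp add: bilin_def)
  then show ?thesis by (simp add: sum_single)
qed

lemma ring_group_algebra:
  assumes "monoid G"
  shows "ring (group_algebra G)"
proof -
  interpret monoid G by fact
  show ?thesis
  proof (rule ringI)
    show "abelian_group (group_algebra G)"
    proof (rule abelian_groupI)
      fix x assume "x \<in> carrier (group_algebra G)"
      then show "\<exists>y\<in>carrier (group_algebra G). y \<oplus>\<^bsub>group_algebra G\<^esub> x = \<zero>\<^bsub>group_algebra G\<^esub>"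
        by (intro bexI[of _ "- x"]) (auto simp: group_algebra_def)
    qed (use Poly_Mapping.keys_add in \<open>fastforce simp: group_algebra_def algebra_simps\<close>)+
    show "monoid (group_algebra G)"
    proof (rule monoidI)
      fix x y assume "x \<in> carrier (group_algebra G)" "y \<in> carrier (group_algebra G)"
      then show "x \<otimes>\<^bsub>group_algebra G\<^esub> y \<in> carrier (group_algebra G)"
        using keys_bilin[of "mult G" x y] by (fastforce simp: group_algebra_def)
    next
      show "\<one>\<^bsub>group_algebra G\<^esub> \<in> carrier (group_algebra G)"
        by (simp add: group_algebra_def)
    next
      fix x y z
      assume "x \<in> carrier (group_algebra G)" "y \<in> carrier (group_algebra G)"
        "z \<in> carrier (group_algebra G)"
      then show "x \<otimes>\<^bsub>group_algebra G\<^esub> y \<otimes>\<^bsub>group_algebra G\<^esub> z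
          = x \<otimes>\<^bsub>group_algebra G\<^esub> (y \<otimes>\<^bsub>group_algebra G\<^esub> z)"
        by (auto simp: group_algebra_def subset_iff intro!: bilin_assoc m_assoc)
    next
      fix x assume "x \<in> carrier (group_algebra G)"
      then show "\<one>\<^bsub>group_algebra G\<^esub> \<otimes>\<^bsub>group_algebra G\<^esub> x = x"
        and "x \<otimes>\<^bsub>group_algebra G\<^esub> \<one>\<^bsub>group_algebra G\<^esub> = x"
        by (auto simp: group_algebra_def subset_iff intro!: bilin_unit_left bilin_unit_right)
    qed
  qed (simp_all add: group_algebra_def bilin_add_left bilin_add_right)
qed

lemma ring_QS: "ring (QS n)"
  unfolding QS_def by (intro ring_group_algebra group.is_monoid sym_group_is_group)

lemma lookup_xy:
  assumes "finite I" "length \<aa> = card I" "k < card I"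
  shows "Poly_Mapping.lookup (xy I \<aa>) (X (sorted_list_of_set I ! k)) = fst (\<aa> ! k)"
    and "Poly_Mapping.lookup (xy I \<aa>) (Y (sorted_list_of_set I ! k)) = snd (\<aa> ! k)"
proof -
  have "sorted_list_of_set I ! j = sorted_list_of_set I ! k \<longleftrightarrow> j = k" if "j < card I" for j
    using assms that by (simp add: nth_eq_iff_index_eq)
  then have "(\<Sum>j<card I. if sorted_list_of_set I ! j = sorted_list_of_set I ! k then f j else 0)
      = (\<Sum>j<card I. if j = k then f j else 0)" for f :: "nat \<Rightarrow> nat"
    by (intro sum.cong) auto
  then show "Poly_Mapping.lookup (xy I \<aa>) (X (sorted_list_of_set I ! k)) = fst (\<aa> ! k)"
    and "Poly_Mapping.lookup (xy I \<aa>) (Y (sorted_list_of_set I ! k)) = snd (\<aa> ! k)"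
    using assms
    by (simp_all add: xy_def lookup_sum lookup_add lookup_single when_def)
qed

lemma lookup_xy_outside:
  assumes "finite I" "length \<aa> = card I" "i \<notin> I"
  shows "Poly_Mapping.lookup (xy I \<aa>) (X i) = 0" "Poly_Mapping.lookup (xy I \<aa>) (Y i) = 0"
proof -
  have "sorted_list_of_set I ! j \<noteq> i" if "j < card I" for j
    using assms that nth_mem[of j "sorted_list_of_set I"] by auto
  then show "Poly_Mapping.lookup (xy I \<aa>) (X i) = 0" "Poly_Mapping.lookup (xy I \<aa>) (Y i) = 0"
    using assms by (simp_all add: xy_def lookup_sum lookup_add lookup_single when_def)
qed

lemma mono_set_xy:
  assumes "finite I" "bicomposition \<aa>" "length \<aa> = card I"
  shows "mono_set (xy I \<aa>) = I"
proof (rule Set.set_eqI)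
  fix i
  show "i \<in> mono_set (xy I \<aa>) \<longleftrightarrow> i \<in> I"
  proof (cases "i \<in> I")
    case True
    then obtain k where k: "k < card I" "i = sorted_list_of_set I ! k"
      using assms(1) by (metis in_set_conv_nth sorted_list_of_set.length_sorted_key_list_of_set
          sorted_list_of_set.set_sorted_key_list_of_set)
    have "\<aa> ! k \<noteq> (0, 0)"
      using assms k nth_mem[of k \<aa>] unfolding bicomposition_def by metis
    then show ?thesis
      using True k assms by (auto simp: mono_set_def lookup_xy prod_eq_iff)
  next
    case False
    then show ?thesis using assms by (simp add: mono_set_def lookup_xy_outside)
  qed
qed

lemma mono_bicomp_xy:
  assumes "finite I" "bicomposition \<aa>" "length \<aa> = card I"
  shows "mono_bicomp (xy I \<aa>) = \<aa>"
  unfolding mono_bicomp_def mono_set_xy[OF assms]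
  using assms by (intro nth_equalityI) (auto simp: lookup_xy)

lemma finite_mono_set [simp]: "finite (mono_set m)"
proof -
  have "mono_set m \<subseteq> X -` Poly_Mapping.keys m \<union> Y -` Poly_Mapping.keys m"
    by (auto simp: mono_set_def in_keys_iff)
  moreover have "finite (X -` Poly_Mapping.keys m \<union> Y -` Poly_Mapping.keys m)"
    by (auto intro!: finite_vimageI simp: inj_def)
  ultimately show ?thesis by (rule finite_subset)
qed

lemma length_mono_bicomp [simp]: "length (mono_bicomp m) = card (mono_set m)"
  by (simp add: mono_bicomp_def)

lemma bicomposition_mono_bicomp: "bicomposition (mono_bicomp m)"
proof -
  have "(Poly_Mapping.lookup m (X i), Poly_Mapping.lookup m (Y i)) \<noteq> (0, 0)"
    if "i \<in> mono_set m" for i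
    using that by (auto simp: mono_set_def)
  then show ?thesis
    by (force simp: bicomposition_def mono_bicomp_def)
qed

lemma xy_mono_set_mono_bicomp: "xy (mono_set m) (mono_bicomp m) = m"
proof (rule poly_mapping_eqI)
  fix v
  define i where "i = (case v of X i \<Rightarrow> i | Y i \<Rightarrow> i)"
  have v: "v = X i \<or> v = Y i" by (cases v) (auto simp: i_def)
  show "Poly_Mapping.lookup (xy (mono_set m) (mono_bicomp m)) v = Poly_Mapping.lookup m v"
  proof (cases "i \<in> mono_set m")
    case True
    then obtain k where k: "k < card (mono_set m)" "i = sorted_list_of_set (mono_set m) ! k"
      by (metis in_set_conv_nth sorted_list_of_set.length_sorted_key_list_of_set
          sorted_list_of_set.set_sorted_key_list_of_set finite_mono_set)
    then have "mono_bicomp m ! k = (Poly_Mapping.lookup m (X i), Poly_Mapping.lookup m (Y i))"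
      by (simp add: mono_bicomp_def)
    then show ?thesis using v k by (auto simp: lookup_xy)
  next
    case False
    then show ?thesis using v by (auto simp: lookup_xy_outside) (auto simp: mono_set_def)
  qed
qed

lemma hivert_mono_xy:
  assumes "finite I" "bicomposition \<aa>" "length \<aa> = card I"
  shows "hivert_mono \<sigma> (xy I \<aa>) = xy (\<sigma> ` I) \<aa>"
  by (simp add: hivert_mono_def mono_set_xy[OF assms] mono_bicomp_xy[OF assms])

lemma hivert_mono_comp:
  assumes "inj \<tau>"
  shows "hivert_mono (\<sigma> \<circ> \<tau>) m = hivert_mono \<sigma> (hivert_mono \<tau> m)"
proof -
  have "hivert_mono \<sigma> (xy (\<tau> ` mono_set m) (mono_bicomp m))
      = xy (\<sigma> ` \<tau> ` mono_set m) (mono_bicomp m)"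
    using assms
    by (intro hivert_mono_xy)
      (auto simp: bicomposition_mono_bicomp card_image inj_on_subset)
  then show ?thesis by (simp add: hivert_mono_def image_comp)
qed

lemma polys_iff: "f \<in> polys n \<longleftrightarrow> (\<forall>m\<in>Poly_Mapping.keys f. mono_set m \<subseteq> {1..n})"
proof -
  have "Poly_Mapping.keys m \<subseteq> X ` {1..n} \<union> Y ` {1..n} \<longleftrightarrow> mono_set m \<subseteq> {1..n}" for m
  proof
    assume "Poly_Mapping.keys m \<subseteq> X ` {1..n} \<union> Y ` {1..n}"
    then show "mono_set m \<subseteq> {1..n}"
      unfolding mono_set_def in_keys_iff[symmetric] by blast
  next
    assume A: "mono_set m \<subseteq> {1..n}"
    show "Poly_Mapping.keys m \<subseteq> X ` {1..n} \<union> Y ` {1..n}"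
    proof
      fix v assume "v \<in> Poly_Mapping.keys m"
      then show "v \<in> X ` {1..n} \<union> Y ` {1..n}"
        using A by (cases v) (auto simp: mono_set_def in_keys_iff subset_iff)
    qed
  qed
  then show ?thesis by (simp add: polys_def)
qed

lemma mono_set_hivert_mono:
  assumes "inj \<sigma>"
  shows "mono_set (hivert_mono \<sigma> m) = \<sigma> ` mono_set m"
  unfolding hivert_mono_def using assms
  by (intro mono_set_xy) (auto simp: bicomposition_mono_bicomp card_image inj_on_subset)

lemma algebra_action_hivert: "algebra_action (QS n) (polys n) hivert"
proof -
  have perm: "\<sigma> permutes {1..n}" if "a \<in> carrier (QS n)" "\<sigma> \<in> Poly_Mapping.keys a" for a \<sigma>
    using that by (auto simp: QS_def group_algebra_def sym_group_def)
  have closed: "hivert a f \<in> polys n" if "a \<in> carrier (QS n)" "f \<in> polys n" for a f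
    unfolding polys_iff
  proof
    fix m assume "m \<in> Poly_Mapping.keys (hivert a f)"
    then obtain \<sigma> m' where m: "\<sigma> \<in> Poly_Mapping.keys a" "m' \<in> Poly_Mapping.keys f"
        "m = hivert_mono \<sigma> m'"
      using keys_bilin[of hivert_mono a f] by (auto simp: hivert_def)
    then have s: "\<sigma> permutes {1..n}" using perm that by blast
    have "\<sigma> ` mono_set m' \<subseteq> \<sigma> ` {1..n}"
      using that m(2) by (intro image_mono) (auto simp: polys_iff)
    then show "mono_set m \<subseteq> {1..n}"
      using m s by (simp add: mono_set_hivert_mono permutes_inj permutes_image)
  qed
  have unit: "hivert \<one>\<^bsub>QS n\<^esub> f = f" for f
    by (auto simp: hivert_def QS_def group_algebra_def sym_group_def hivert_mono_def
        xy_mono_set_mono_bicomp intro!: bilin_unit_left)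
  have assoc: "hivert (a \<otimes>\<^bsub>QS n\<^esub> b) f = hivert a (hivert b f)"
    if "a \<in> carrier (QS n)" "b \<in> carrier (QS n)" for a b f
    using that perm
    by (auto simp: hivert_def QS_def group_algebra_def sym_group_def permutes_inj
        intro!: bilin_assoc hivert_mono_comp)
  show ?thesis
    unfolding algebra_action_def using closed unit assoc
    by (auto simp: hivert_def QS_def group_algebra_def bilin_add_left bilin_add_right
        bilin_scal_left bilin_scal_right)
qed

end

theory Submission
  imports Defs
begin

text \<open>
  On the monomials with a fixed bicomposition of length \<open>k\<close>, the group algebra acts as on the
  \<open>k\<close>-element subsets of \<open>{1..n}\<close>. Hence an element \<open>a = \<Sum>\<sigma>. a\<^sub>\<sigma> \<sigma>\<close> acts as zero iff, for
  all subsets \<open>I\<close> and \<open>J\<close>, the coefficients \<open>a\<^sub>\<sigma>\<close> with \<open>\<sigma>(I) = J\<close> sum to zero.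

  The element \<^const>\<open>E123\<close> is the alternating sum of the permutations of \<open>1, 2, 3\<close>. Of these three
  points, two lie both inside or both outside of a given \<open>I\<close>; their transposition fixes \<open>I\<close>, so that
  the terms cancel in pairs (\<open>E123_in_Ker\<close>). This gives one inclusion. The other one is a comparison
  of two facts about 321-avoiding permutations, in which no dimension is computed.

  Spanning (\<open>QS_reduce\<close>): the ideal contains the alternating sum over any three points
  \<open>i < j < k\<close>. If \<open>\<sigma>\<close> has a 321 pattern at these positions, multiplying that sum by \<open>\<sigma>\<close> expresses
  \<open>\<sigma>\<close>, modulo the ideal, by the five other arrangements of the values at these positions. They arise
  from \<open>\<sigma>\<close> by undoing inversions, which increases \<open>\<Sum>p. p \<sigma>(p)\<close>, so the rewriting terminates.

  Independence (\<open>avoiding_span_independent\<close>): let \<open>I = {p. p < \<sigma>(p)}\<close> and \<open>J = \<sigma>(I)\<close>, and let \<open>d(\<tau>)\<close>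
  be the sum of the positive differences \<open>\<tau>(p) - p\<close>. If \<open>\<tau>(I) = J\<close> then
  \<open>d(\<tau>) \<ge> \<Sum>J - \<Sum>I = d(\<sigma>)\<close>, and equality forces \<open>\<tau>(p) \<ge> p\<close> on \<open>I\<close> and \<open>\<tau>(p) \<le> p\<close> off \<open>I\<close>.
  A 321-avoiding permutation increases on its weak exceedances and on the positions with
  \<open>\<tau>(p) \<le> p\<close>; hence \<open>\<tau>\<close> is increasing from \<open>I\<close> to \<open>J\<close> and between the complements, as \<open>\<sigma>\<close> is, and
  \<open>\<tau> = \<sigma>\<close>. So a 321-avoiding \<open>\<sigma>\<close> of maximal \<open>d\<close> in an element of the kernel would be alone in its
  coefficient sum, which is absurd.

  Finally, each Temperley--Lieb relator is \<open>1/8\<close> of the alternating sum over three consecutive points,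
  and these sums are conjugate to \<^const>\<open>E123\<close>. So \<^const>\<open>TL_ideal\<close> is the kernel as well.
\<close>

section \<open>The quotient of an algebra by the kernel of an action\<close>

lemma algebra_actionD:
  assumes "algebra_action A V \<rho>" "a \<in> carrier A" "f \<in> V"
  shows "\<rho> a f \<in> V" "g \<in> V \<Longrightarrow> \<rho> a (f + g) = \<rho> a f + \<rho> a g" "\<rho> a (scal c f) = scal c (\<rho> a f)"
    "b \<in> carrier A \<Longrightarrow> \<rho> (a \<oplus>\<^bsub>A\<^esub> b) f = \<rho> a f + \<rho> b f" "\<rho> (c \<odot>\<^bsub>A\<^esub> a) f = scal c (\<rho> a f)"
    "\<rho> \<one>\<^bsub>A\<^esub> f = f" "b \<in> carrier A \<Longrightarrow> \<rho> (a \<otimes>\<^bsub>A\<^esub> b) f = \<rho> a (\<rho> b f)"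
  using assms unfolding algebra_action_def by blast+

lemma action_coset:
  assumes A: "ring A" and act: "algebra_action A V \<rho>"
    and a: "a \<in> carrier A" and f: "f \<in> V"
    and x: "x \<in> action_kernel A V \<rho> +>\<^bsub>A\<^esub> a"
  shows "x \<in> carrier A" "\<rho> x f = \<rho> a f"
proof -
  interpret ring A by fact
  obtain k where k: "k \<in> carrier A" "\<rho> k f = 0" "x = k \<oplus>\<^bsub>A\<^esub> a"
    using x f by (auto simp: a_r_coset_def' action_kernel_def)
  then show "x \<in> carrier A" "\<rho> x f = \<rho> a f"
    using a f algebra_actionD(4)[OF act, of k f a] by auto
qed

lemma ideal_action_kernel:
  assumes A: "ring A" and act: "algebra_action A V \<rho>"
  shows "ideal (action_kernel A V \<rho>) A"
proof -
  interpret ring A by fact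
  note clo = algebra_actionD(1)[OF act]
  note add = algebra_actionD(4)[OF act]
  note mul = algebra_actionD(7)[OF act]
  have zero: "\<rho> \<zero>\<^bsub>A\<^esub> f = 0" if "f \<in> V" for f
    using add[of "\<zero>\<^bsub>A\<^esub>" f "\<zero>\<^bsub>A\<^esub>"] that by simp
  have zero_right: "\<rho> a 0 = 0" if "a \<in> carrier A" "f \<in> V" for a f
  proof -
    have "\<rho> a 0 = \<rho> a (\<rho> \<zero>\<^bsub>A\<^esub> f)" using zero that by simp
    also have "\<dots> = \<rho> \<zero>\<^bsub>A\<^esub> f" using mul[of a f "\<zero>\<^bsub>A\<^esub>"] that by simp
    finally show ?thesis using zero that by simp
  qed
  have neg: "\<rho> (\<ominus>\<^bsub>A\<^esub> a) f = 0" if "a \<in> carrier A" "f \<in> V" "\<rho> a f = 0" for a f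
    using add[of "\<ominus>\<^bsub>A\<^esub> a" f a] that zero by (simp add: l_neg)
  show ?thesis
  proof (rule idealI)
    show "subgroup (action_kernel A V \<rho>) (add_monoid A)"
      by (rule add.subgroupI) (auto simp: action_kernel_def zero add neg a_inv_def[symmetric])
  qed (auto simp: action_kernel_def mul clo zero_right intro: A)
qed

lemma kernel_coset_eqI:
  assumes A: "ring A" and act: "algebra_action A V \<rho>"
    and a: "a \<in> carrier A" and b: "b \<in> carrier A"
    and eq: "\<And>f. f \<in> V \<Longrightarrow> \<rho> a f = \<rho> b f"
  shows "action_kernel A V \<rho> +>\<^bsub>A\<^esub> a = action_kernel A V \<rho> +>\<^bsub>A\<^esub> b"
proof -
  interpret ring A by fact
  have "\<rho> (a \<ominus>\<^bsub>A\<^esub> b) f = 0" if "f \<in> V" for f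
  proof -
    have "\<rho> (a \<ominus>\<^bsub>A\<^esub> b \<oplus>\<^bsub>A\<^esub> b) f = \<rho> (a \<ominus>\<^bsub>A\<^esub> b) f + \<rho> b f"
      using a b that by (intro algebra_actionD(4)[OF act]) auto
    moreover have "a \<ominus>\<^bsub>A\<^esub> b \<oplus>\<^bsub>A\<^esub> b = a"
      using a b by (simp add: minus_eq a_assoc l_neg)
    ultimately show ?thesis using eq[OF that] by (metis add_cancel_left_left)
  qed
  then have "a \<ominus>\<^bsub>A\<^esub> b \<in> action_kernel A V \<rho>"
    using a b by (auto simp: action_kernel_def)
  then show ?thesis
    using quotient_eq_iff_same_a_r_cos[OF ideal_action_kernel[OF A act] a b] by simp
qed

text \<open>
  The quotient acts through representatives; the closure of \<open>V\<close> under linear combinations is not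
  part of \<^const>\<open>algebra_action\<close> and is needed for the linearity of the induced maps.
\<close>

lemma faithful_quotient_action:
  assumes A: "ring A" and act: "algebra_action A V \<rho>"
    and smult: "\<And>c a. a \<in> carrier A \<Longrightarrow> c \<odot>\<^bsub>A\<^esub> a \<in> carrier A"
    and V: "\<And>f g. f \<in> V \<Longrightarrow> g \<in> V \<Longrightarrow> f + g \<in> V" "\<And>c f. f \<in> V \<Longrightarrow> scal c f \<in> V"
  defines "K \<equiv> action_kernel A V \<rho>"
  shows "\<exists>\<rho>'. faithful_action (quot_algebra A K) V \<rho>' \<and>
    (\<forall>a\<in>carrier A. \<forall>f\<in>V. \<rho>' (K +>\<^bsub>A\<^esub> a) f = \<rho> a f)"
proof -
  interpret ideal K A unfolding K_def by (rule ideal_action_kernel[OF A act])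
  have zero_closed_K: "\<zero>\<^bsub>A\<^esub> \<in> K" by (rule additive_subgroup.zero_closed[OF is_additive_subgroup])
  define \<rho>' where "\<rho>' X f = \<rho> (SOME a. a \<in> X) f" for X f
  have \<rho>': "\<rho>' (K +>\<^bsub>A\<^esub> a) f = \<rho> a f" if "a \<in> carrier A" "f \<in> V" for a f
  proof -
    have "(SOME x. x \<in> K +>\<^bsub>A\<^esub> a) \<in> K +>\<^bsub>A\<^esub> a"
      using a_rcos_self[OF that(1)] by (rule someI)
    then show ?thesis
      using action_coset[OF A act that] by (simp add: \<rho>'_def K_def)
  qed
  have smult_coset: "c \<odot>\<^bsub>quot_algebra A K\<^esub> (K +>\<^bsub>A\<^esub> a) = K +>\<^bsub>A\<^esub> (c \<odot>\<^bsub>A\<^esub> a)"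
    if a: "a \<in> carrier A" for c a
  proof -
    have "K +>\<^bsub>A\<^esub> (c \<odot>\<^bsub>A\<^esub> x) = K +>\<^bsub>A\<^esub> (c \<odot>\<^bsub>A\<^esub> a)" if x: "x \<in> K +>\<^bsub>A\<^esub> a" for x
    proof -
      have xc: "x \<in> carrier A" using x a a_r_coset_subset_G[OF a_subset] by blast
      have "\<rho> (c \<odot>\<^bsub>A\<^esub> x) f = \<rho> (c \<odot>\<^bsub>A\<^esub> a) f" if "f \<in> V" for f
      proof -
        have "\<rho> x f = \<rho> a f" using action_coset(2)[OF A act a that] x by (simp add: K_def)
        then show ?thesis
          by (simp only: algebra_actionD(5)[OF act a that] algebra_actionD(5)[OF act xc that])
      qed
      then show ?thesis
        unfolding K_def by (intro kernel_coset_eqI[OF A act] smult xc a)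
    qed
    then have "(\<Union>x\<in>K +>\<^bsub>A\<^esub> a. K +>\<^bsub>A\<^esub> (c \<odot>\<^bsub>A\<^esub> x))
        = (\<Union>x\<in>K +>\<^bsub>A\<^esub> a. K +>\<^bsub>A\<^esub> (c \<odot>\<^bsub>A\<^esub> a))"
      by (rule SUP_cong[OF refl])
    also have "\<dots> = K +>\<^bsub>A\<^esub> (c \<odot>\<^bsub>A\<^esub> a)" using a_rcos_self[OF a] by blast
    finally show ?thesis by (simp add: quot_algebra_def)
  qed
  have carrier: "carrier (quot_algebra A K) = (\<lambda>a. K +>\<^bsub>A\<^esub> a) ` carrier A"
    by (auto simp: quot_algebra_def FactRing_def A_RCOSETS_def')
  have ops: "\<one>\<^bsub>quot_algebra A K\<^esub> = K +>\<^bsub>A\<^esub> \<one>\<^bsub>A\<^esub>" "\<zero>\<^bsub>quot_algebra A K\<^esub> = K"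
    by (simp_all add: quot_algebra_def FactRing_def)
  have add_coset: "(K +>\<^bsub>A\<^esub> a) \<oplus>\<^bsub>quot_algebra A K\<^esub> (K +>\<^bsub>A\<^esub> b) = K +>\<^bsub>A\<^esub> (a \<oplus>\<^bsub>A\<^esub> b)"
    if "a \<in> carrier A" "b \<in> carrier A" for a b
    using that by (simp add: quot_algebra_def FactRing_def a_rcos_sum)
  have mult_coset: "(K +>\<^bsub>A\<^esub> a) \<otimes>\<^bsub>quot_algebra A K\<^esub> (K +>\<^bsub>A\<^esub> b) = K +>\<^bsub>A\<^esub> (a \<otimes>\<^bsub>A\<^esub> b)"
    if "a \<in> carrier A" "b \<in> carrier A" for a b
    using that by (simp add: quot_algebra_def FactRing_def rcoset_mult_add)
  have act': "algebra_action (quot_algebra A K) V \<rho>'"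
    unfolding algebra_action_def
    by (auto simp: carrier ops add_coset mult_coset smult_coset \<rho>' smult algebra_actionD[OF act]
      algebra_actionD(6)[OF act one_closed] V)
  have "action_kernel (quot_algebra A K) V \<rho>' = {K}"
  proof (intro equalityI subsetI)
    fix X assume "X \<in> action_kernel (quot_algebra A K) V \<rho>'"
    then obtain a where a: "a \<in> carrier A" "X = K +>\<^bsub>A\<^esub> a" "\<forall>f\<in>V. \<rho>' X f = 0"
      unfolding action_kernel_def carrier by blast
    have "\<rho> a f = 0" if "f \<in> V" for f
      using \<rho>'[OF a(1) that] a(2,3) that by metis
    then have "a \<in> K" unfolding K_def action_kernel_def using a(1) by blast
    then show "X \<in> {K}" using a(2) a_rcos_const by simp
  next
    fix X assume "X \<in> {K}"
    then have X: "X = K +>\<^bsub>A\<^esub> \<zero>\<^bsub>A\<^esub>" using a_rcos_const[OF zero_closed_K] by simp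
    have "\<rho> \<zero>\<^bsub>A\<^esub> f = 0" if "f \<in> V" for f
      using zero_closed_K that unfolding K_def action_kernel_def by blast
    then have "\<rho>' X f = 0" if "f \<in> V" for f
      unfolding X \<rho>'[OF zero_closed that] using that by blast
    then show "X \<in> action_kernel (quot_algebra A K) V \<rho>'"
      unfolding action_kernel_def carrier using X zero_closed by blast
  qed
  then show ?thesis
    unfolding faithful_action_def ops using act' \<rho>' by blast
qed

section \<open>Ideals of the group algebra\<close>

lemma bilin_diff_left: "bilin h (a - a') b = bilin h a b - bilin h a' b"
  using bilin_add_left[of h "a - a'" a' b] by simp

lemma bilin_diff_right: "bilin h a (b - b') = bilin h a b - bilin h a b'"
  using bilin_add_right[of h a "b - b'" b'] by simp

lemma scal_diff: "scal c (f - g) = scal c f - scal c g"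
  by (rule poly_mapping_eqI) (simp add: lookup_minus algebra_simps)

lemma carrier_QS: "a \<in> carrier (QS n) \<longleftrightarrow> (\<forall>\<sigma>\<in>Poly_Mapping.keys a. \<sigma> permutes {1..n})"
  by (auto simp: QS_def group_algebra_def sym_group_def)

lemma QS_simps:
  "a \<otimes>\<^bsub>QS n\<^esub> b = bilin (\<circ>) a b" "a \<oplus>\<^bsub>QS n\<^esub> b = a + b" "\<zero>\<^bsub>QS n\<^esub> = 0"
  "c \<odot>\<^bsub>QS n\<^esub> a = scal c a"
  by (simp_all add: QS_def group_algebra_def sym_group_def)

lemma bilin_perm_elt: "bilin h (perm_elt \<sigma>) (perm_elt \<tau>) = perm_elt (h \<sigma> \<tau>)"
  by (simp add: perm_elt_def bilin_single)

lemma perm_elt_carrier: "\<sigma> permutes {1..n} \<Longrightarrow> perm_elt \<sigma> \<in> carrier (QS n)"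
  by (simp add: carrier_QS perm_elt_def)

lemma QS_expand: "a = (\<Sum>\<sigma>\<in>Poly_Mapping.keys a. scal (Poly_Mapping.lookup a \<sigma>) (perm_elt \<sigma>))"
  by (simp add: perm_elt_def scal_single sum_single)

lemma QS_carrier_closed:
  assumes "a \<in> carrier (QS n)" "b \<in> carrier (QS n)"
  shows "a + b \<in> carrier (QS n)" "a - b \<in> carrier (QS n)"
  using assms Poly_Mapping.keys_add[of a b] Poly_Mapping.keys_diff[of a b]
  unfolding carrier_QS by blast+

lemma QS_carrier_scal: "a \<in> carrier (QS n) \<Longrightarrow> scal c a \<in> carrier (QS n)"
  using keys_scal[of c a] unfolding carrier_QS by blast

lemma ideal_QS_closed:
  assumes I: "ideal I (QS n)" and a: "a \<in> I"
  shows "scal c a \<in> I" "b \<in> I \<Longrightarrow> a + b \<in> I" "b \<in> I \<Longrightarrow> a - b \<in> I"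
    "b \<in> carrier (QS n) \<Longrightarrow> bilin (\<circ>) b a \<in> I" "b \<in> carrier (QS n) \<Longrightarrow> bilin (\<circ>) a b \<in> I"
proof -
  interpret ideal I "QS n" by fact
  show "bilin (\<circ>) b a \<in> I" if "b \<in> carrier (QS n)"
    using I_l_closed[OF a that] by (simp add: QS_simps)
  show "bilin (\<circ>) a b \<in> I" if "b \<in> carrier (QS n)"
    using I_r_closed[OF a that] by (simp add: QS_simps)
  show add: "a + b \<in> I" if "b \<in> I" for b
    using additive_subgroup.a_closed[OF is_additive_subgroup a that] by (simp add: QS_simps)
  \<comment> \<open>A scalar multiple is a product with a multiple of the unit.\<close>
  have scal: "scal c x \<in> I" if x: "x \<in> I" for c x
  proof -
    have "scal c (perm_elt id) \<in> carrier (QS n)"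
      by (intro QS_carrier_scal perm_elt_carrier permutes_id)
    then have "bilin (\<circ>) (scal c (perm_elt id)) x \<in> I"
      using I_l_closed[OF x] by (simp add: QS_simps)
    then show ?thesis
      by (simp add: bilin_scal_left perm_elt_def bilin_unit_left)
  qed
  from scal[OF a] show "scal c a \<in> I" .
  show "a - b \<in> I" if "b \<in> I"
  proof -
    have "a - b = a + scal (-1) b"
      by (rule poly_mapping_eqI) (simp add: lookup_minus lookup_add)
    then show ?thesis by (simp only:) (intro add scal that)
  qed
qed

lemma ideal_QS_sum:
  assumes "ideal I (QS n)" "\<And>s. s \<in> S \<Longrightarrow> f s \<in> I"
  shows "(\<Sum>s\<in>S. f s) \<in> I"
proof -
  have "0 \<in> I"
    using additive_subgroup.zero_closed[OF ideal.axioms(1)[OF assms(1)]] by (simp add: QS_simps)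
  then show ?thesis
    using assms(2) by (induction S rule: infinite_finite_induct)
      (auto intro: ideal_QS_closed[OF assms(1)])
qed

section \<open>Antisymmetrizers of three points\<close>

text \<open>
  The alternating sum over the permutations of \<open>{i, j, k}\<close>, for distinct \<open>i\<close>, \<open>j\<close>, \<open>k\<close>; the two
  3-cycles are written as products of the transpositions \<open>(i j)\<close> and \<open>(j k)\<close>.
\<close>

definition antisym3 :: "nat \<Rightarrow> nat \<Rightarrow> nat \<Rightarrow> ((nat \<Rightarrow> nat) \<Rightarrow>\<^sub>0 rat)" where
  "antisym3 i j k = perm_elt id - perm_elt (transpose j k) - perm_elt (transpose i j)
     + perm_elt (transpose i j \<circ> transpose j k) + perm_elt (transpose j k \<circ> transpose i j)
     - perm_elt (transpose i k)"

lemma E123_eq_antisym3: "E123 = antisym3 1 2 3"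
proof -
  have words: "one_line [1,2,3] = id" "one_line [1,3,2] = transpose 2 3"
    "one_line [2,1,3] = transpose 1 2" "one_line [3,2,1] = transpose 1 3"
    "one_line [2,3,1] = transpose 1 2 \<circ> transpose 2 3"
    "one_line [3,1,2] = transpose 2 3 \<circ> transpose 1 2"
    by (rule ext; force simp: one_line_def transpose_def nth_Cons split: nat.splits)+
  show ?thesis by (simp only: E123_def antisym3_def words)
qed

lemma antisym3_carrier:
  assumes "i \<in> {1..n}" "j \<in> {1..n}" "k \<in> {1..n}"
  shows "antisym3 i j k \<in> carrier (QS n)"
  unfolding antisym3_def using assms
  by (intro QS_carrier_closed perm_elt_carrier permutes_id permutes_compose permutes_swap_id)

lemma antisym3_conj:
  assumes "\<pi> \<circ> \<pi>' = id" "\<pi>' \<circ> \<pi> = id"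
  shows "bilin (\<circ>) (bilin (\<circ>) (perm_elt \<pi>) (antisym3 i j k)) (perm_elt \<pi>')
    = antisym3 (\<pi> i) (\<pi> j) (\<pi> k)"
proof -
  have [simp]: "\<pi> (\<pi>' x) = x" "\<pi>' (\<pi> x) = x" for x
    using assms by (simp_all add: pointfree_idE)
  have t: "\<pi> \<circ> transpose a b \<circ> \<pi>' = transpose (\<pi> a) (\<pi> b)" for a b
  proof
    fix x
    have "\<pi>' x = a \<longleftrightarrow> x = \<pi> a" for a by auto
    then show "(\<pi> \<circ> transpose a b \<circ> \<pi>') x = transpose (\<pi> a) (\<pi> b) x"
      by (simp add: transpose_def)
  qed
  have tt: "\<pi> \<circ> (transpose a b \<circ> transpose c d) \<circ> \<pi>'
      = transpose (\<pi> a) (\<pi> b) \<circ> transpose (\<pi> c) (\<pi> d)" for a b c d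
    unfolding t[symmetric] by (simp add: fun_eq_iff)
  show ?thesis
    by (simp add: antisym3_def bilin_diff_left bilin_diff_right bilin_add_left bilin_add_right
        bilin_perm_elt t tt assms)
qed

lemma ideal_antisym3:
  assumes I: "ideal I (QS n)" and "E123 \<in> I"
    and ijk: "1 \<le> i" "i < j" "j < k" "k \<le> n"
  shows "antisym3 i j k \<in> I"
proof -
  \<comment> \<open>A permutation that sends \<open>1, 2, 3\<close> to \<open>i, j, k\<close> conjugates one sum to the other.\<close>
  obtain \<pi> where \<pi>: "\<pi> permutes {1..n}" "\<pi> 1 = i" "\<pi> 2 = j" "\<pi> 3 = k"
  proof
    let ?p = "transpose 1 i"
    let ?q = "transpose (?p 2) j \<circ> ?p"
    let ?r = "transpose (?q 3) k \<circ> ?q"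
    show "?r permutes {1..n}"
      using ijk by (intro permutes_compose permutes_swap_id) (auto simp: transpose_def)
    show "?r 1 = i" "?r 2 = j" "?r 3 = k"
      using ijk by (auto simp: transpose_def)
  qed
  let ?\<pi>' = "inv_into UNIV \<pi>"
  have "bilin (\<circ>) (bilin (\<circ>) (perm_elt \<pi>) E123) (perm_elt ?\<pi>') \<in> I"
    using assms(2) by (intro ideal_QS_closed[OF I] perm_elt_carrier permutes_inv \<pi>(1))
  then show ?thesis
    by (simp only: E123_eq_antisym3 antisym3_conj[OF permutes_inv_o[OF \<pi>(1)]] \<pi>(2-4))
qed

lemma TL_relator_eq:
  assumes "s \<circ> s = id"
  defines "e \<equiv> \<lambda>s. scal (1/2) (perm_elt id - perm_elt s)"
  shows "bilin (\<circ>) (bilin (\<circ>) (e s) (e t)) (e s) - scal (1/4) (e s)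
    = scal (1/8) (perm_elt id - perm_elt s - perm_elt t + perm_elt (s \<circ> t) + perm_elt (t \<circ> s)
        - perm_elt (s \<circ> t \<circ> s))"
  unfolding e_def
  by (rule poly_mapping_eqI)
    (simp add: bilin_scal_left bilin_scal_right bilin_diff_left bilin_diff_right bilin_perm_elt
      assms(1) lookup_minus lookup_add algebra_simps)

text \<open>
  Both orders of two adjacent generators give the same relator, since
  \<open>s\<^sub>i s\<^sub>i\<^sub>+\<^sub>1 s\<^sub>i = s\<^sub>i\<^sub>+\<^sub>1 s\<^sub>i s\<^sub>i\<^sub>+\<^sub>1\<close> is the transposition of \<open>i\<close> and \<open>i + 2\<close>.
\<close>

lemma TL_relators_eq:
  "TL_relators n = (\<lambda>i. scal (1/8) (antisym3 i (i + 1) (i + 2))) ` {i. 1 \<le> i \<and> i + 2 \<le> n}"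
proof -
  have up: "TL_e i \<otimes>\<^bsub>QS n\<^esub> TL_e (i + 1) \<otimes>\<^bsub>QS n\<^esub> TL_e i - scal (1/4) (TL_e i)
      = scal (1/8) (antisym3 i (i + 1) (i + 2))" for i
  proof -
    have "transpose i (i + 1) \<circ> transpose (i + 1) (i + 2) \<circ> transpose i (i + 1)
        = transpose i (i + 2)"
      by (auto simp: fun_eq_iff transpose_def)
    then show ?thesis
      using TL_relator_eq[of "transpose i (i + 1)" "transpose (i + 1) (i + 2)"]
      by (simp add: TL_e_def QS_simps antisym3_def algebra_simps)
  qed
  have down: "TL_e (i + 1) \<otimes>\<^bsub>QS n\<^esub> TL_e i \<otimes>\<^bsub>QS n\<^esub> TL_e (i + 1) - scal (1/4) (TL_e (i + 1))
      = scal (1/8) (antisym3 i (i + 1) (i + 2))" for i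
  proof -
    have "transpose (i + 1) (i + 2) \<circ> transpose i (i + 1) \<circ> transpose (i + 1) (i + 2)
        = transpose i (i + 2)"
      by (auto simp: fun_eq_iff transpose_def)
    then show ?thesis
      using TL_relator_eq[of "transpose (i + 1) (i + 2)" "transpose i (i + 1)"]
      by (simp add: TL_e_def QS_simps antisym3_def algebra_simps)
  qed
  show ?thesis
  proof (intro equalityI subsetI)
    fix x assume "x \<in> TL_relators n"
    then show "x \<in> (\<lambda>i. scal (1/8) (antisym3 i (i + 1) (i + 2))) ` {i. 1 \<le> i \<and> i + 2 \<le> n}"
      unfolding TL_relators_def using up down by fastforce
  next
    fix x assume "x \<in> (\<lambda>i. scal (1/8) (antisym3 i (i + 1) (i + 2))) ` {i. 1 \<le> i \<and> i + 2 \<le> n}"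
    then obtain i where i: "1 \<le> i" "i + 2 \<le> n" "x = scal (1/8) (antisym3 i (i + 1) (i + 2))"
      by blast
    show "x \<in> TL_relators n"
      unfolding TL_relators_def i(3) up[symmetric, of i] mem_Collect_eq
      by (rule exI[of _ i], rule exI[of _ "i + 1"]) (use i in auto)
  qed
qed

lemma TL_ideal_eq:
  assumes "3 \<le> n"
  shows "TL_ideal n = Idl\<^bsub>QS n\<^esub> {E123}"
proof -
  interpret ring "QS n" by (rule ring_QS)
  have E: "E123 \<in> carrier (QS n)"
    unfolding E123_eq_antisym3 using assms by (intro antisym3_carrier) auto
  have R: "TL_relators n \<subseteq> carrier (QS n)"
    unfolding TL_relators_eq by (auto intro!: QS_carrier_scal antisym3_carrier)
  have I: "ideal (Idl\<^bsub>QS n\<^esub> {E123}) (QS n)" and J: "ideal (TL_ideal n) (QS n)"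
    unfolding TL_ideal_def using E R by (auto intro: genideal_ideal)
  have "E123 \<in> Idl\<^bsub>QS n\<^esub> {E123}" using genideal_self[of "{E123}"] E by auto
  then have "TL_relators n \<subseteq> Idl\<^bsub>QS n\<^esub> {E123}"
    unfolding TL_relators_eq by (auto intro!: ideal_QS_closed[OF I] ideal_antisym3[OF I])
  then have sub: "TL_ideal n \<subseteq> Idl\<^bsub>QS n\<^esub> {E123}"
    unfolding TL_ideal_def using genideal_minimal[OF I] by blast
  have "scal (1/8) E123 \<in> TL_ideal n"
  proof -
    have "scal (1/8) E123 \<in> TL_relators n"
      unfolding TL_relators_eq E123_eq_antisym3
      by (rule image_eqI[of _ _ 1]) (use assms in \<open>auto simp: numeral_2_eq_2 numeral_3_eq_3\<close>)
    then show ?thesis using genideal_self[OF R] by (auto simp: TL_ideal_def)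
  qed
  then have "scal 8 (scal (1/8) E123) \<in> TL_ideal n" by (rule ideal_QS_closed[OF J])
  moreover have "scal 8 (scal (1/8) E123) = E123" by (rule poly_mapping_eqI) simp
  ultimately have "E123 \<in> TL_ideal n" by simp
  then have "Idl\<^bsub>QS n\<^esub> {E123} \<subseteq> TL_ideal n" using genideal_minimal[OF J] by blast
  then show ?thesis using sub by blast
qed


section \<open>Rewriting to 321-avoiding permutations\<close>

text \<open>\<open>\<sigma>\<close> has no three positions in \<open>{1..n}\<close> with decreasing values.\<close>

definition avoids_321 :: "nat \<Rightarrow> (nat \<Rightarrow> nat) \<Rightarrow> bool" where
  "avoids_321 n \<sigma> \<longleftrightarrow> (\<nexists>i j k. 1 \<le> i \<and> i < j \<and> j < k \<and> k \<le> n \<and> \<sigma> k < \<sigma> j \<and> \<sigma> j < \<sigma> i)"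

text \<open>
  As \<open>n - \<sigma> p\<close> is not truncated for a permutation of \<open>{1..n}\<close>, this is a constant minus
  \<open>\<Sum>p. p \<sigma>(p)\<close>: a natural number that decreases when an inversion is undone.
\<close>

definition disorder :: "nat \<Rightarrow> (nat \<Rightarrow> nat) \<Rightarrow> nat" where
  "disorder n \<sigma> = (\<Sum>p = 1..n. p * (n - \<sigma> p))"

lemma disorder_swap:
  assumes \<sigma>: "\<sigma> permutes {1..n}" and ij: "1 \<le> i" "i < j" "j \<le> n" and inv: "\<sigma> j < \<sigma> i"
  shows "disorder n (\<sigma> \<circ> transpose i j) < disorder n \<sigma>"
proof -
  let ?R = "{1..n} - {i} - {j}"
  have split: "disorder n \<tau> = i * (n - \<tau> i) + (j * (n - \<tau> j) + (\<Sum>p\<in>?R. p * (n - \<tau> p)))" for \<tau>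
    unfolding disorder_def using ij
    by (subst sum.remove[of _ i], simp, simp, subst sum.remove[of _ j]) auto
  have "(\<Sum>p\<in>?R. p * (n - (\<sigma> \<circ> transpose i j) p)) = (\<Sum>p\<in>?R. p * (n - \<sigma> p))"
    by (intro sum.cong) (auto simp: transpose_def)
  moreover have "i * (n - \<sigma> j) + j * (n - \<sigma> i) < i * (n - \<sigma> i) + j * (n - \<sigma> j)"
  proof -
    have "\<sigma> i \<le> n" using permutes_in_image[OF \<sigma>, of i] ij by auto
    then obtain u where u: "n = \<sigma> i + u" using le_Suc_ex by blast
    obtain d where d: "\<sigma> i = \<sigma> j + d" "d > 0" using inv less_imp_add_positive by metis
    have e: "n - \<sigma> i = u" "n - \<sigma> j = u + d" using u d by auto
    have "i * d < j * d" using ij d by simp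
    then show ?thesis unfolding e by (simp add: algebra_simps)
  qed
  ultimately show ?thesis unfolding split by simp
qed

text \<open>The rational linear span of the 321-avoiding permutations of \<open>{1..n}\<close>.\<close>

definition avoiding_span :: "nat \<Rightarrow> ((nat \<Rightarrow> nat) \<Rightarrow>\<^sub>0 rat) set" where
  "avoiding_span n = {b. \<forall>\<tau>\<in>Poly_Mapping.keys b. \<tau> permutes {1..n} \<and> avoids_321 n \<tau>}"

lemma avoiding_span_closed:
  assumes "a \<in> avoiding_span n"
  shows "scal c a \<in> avoiding_span n" "b \<in> avoiding_span n \<Longrightarrow> a + b \<in> avoiding_span n"
    "b \<in> avoiding_span n \<Longrightarrow> a - b \<in> avoiding_span n"
  using assms Poly_Mapping.keys_add[of a b] Poly_Mapping.keys_diff[of a b] keys_scal[of c a]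
  unfolding avoiding_span_def by blast+

lemma perm_elt_reduce:
  assumes I: "ideal I (QS n)" and E: "E123 \<in> I" and "\<sigma> permutes {1..n}"
  shows "\<exists>b\<in>avoiding_span n. perm_elt \<sigma> - b \<in> I"
  using assms(3)
proof (induction "disorder n \<sigma>" arbitrary: \<sigma> rule: less_induct)
  case less
  note \<sigma> = less.prems
  \<comment> \<open>\<open>R\<close> is the subspace of elements congruent modulo \<open>I\<close> to an element of the span.\<close>
  define R where "R = {a. \<exists>b\<in>avoiding_span n. a - b \<in> I}"
  have R_add: "a + a' \<in> R" if a: "a \<in> R" "a' \<in> R" for a a'
  proof -
    obtain b b' where b: "b \<in> avoiding_span n" "a - b \<in> I" "b' \<in> avoiding_span n" "a' - b' \<in> I"
      using a unfolding R_def by blast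
    have "a + a' - (b + b') = (a - b) + (a' - b')" by simp
    then have "a + a' - (b + b') \<in> I" using ideal_QS_closed(2)[OF I b(2) b(4)] by (simp only:)
    then show ?thesis unfolding R_def using avoiding_span_closed(2)[OF b(1) b(3)] by blast
  qed
  have R_diff: "a - a' \<in> R" if a: "a \<in> R" "a' \<in> R" for a a'
  proof -
    obtain b b' where b: "b \<in> avoiding_span n" "a - b \<in> I" "b' \<in> avoiding_span n" "a' - b' \<in> I"
      using a unfolding R_def by blast
    have "a - a' - (b - b') = (a - b) - (a' - b')" by simp
    then have "a - a' - (b - b') \<in> I" using ideal_QS_closed(3)[OF I b(2) b(4)] by (simp only:)
    then show ?thesis unfolding R_def using avoiding_span_closed(3)[OF b(1) b(3)] by blast
  qed
  have "perm_elt \<sigma> \<in> R"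
  proof (cases "avoids_321 n \<sigma>")
    case True
    then have "perm_elt \<sigma> \<in> avoiding_span n" using \<sigma> by (simp add: avoiding_span_def perm_elt_def)
    moreover have "perm_elt \<sigma> - perm_elt \<sigma> \<in> I"
      using ideal_QS_sum[OF I, of "{}"] by simp
    ultimately show ?thesis unfolding R_def by blast
  next
    case False
    then obtain i j k where ijk: "1 \<le> i" "i < j" "j < k" "k \<le> n"
      and inv: "\<sigma> k < \<sigma> j" "\<sigma> j < \<sigma> i"
      unfolding avoids_321_def by blast
    let ?ij = "transpose i j" and ?jk = "transpose j k" and ?ik = "transpose i k"
    have swaps: "?ij permutes {1..n}" "?jk permutes {1..n}" "?ik permutes {1..n}"
      using ijk by (auto intro: permutes_swap_id)
    have perms: "(\<sigma> \<circ> ?ij) permutes {1..n}" "(\<sigma> \<circ> ?jk) permutes {1..n}" "(\<sigma> \<circ> ?ik) permutes {1..n}"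
      "(\<sigma> \<circ> ?ij \<circ> ?jk) permutes {1..n}" "(\<sigma> \<circ> ?jk \<circ> ?ij) permutes {1..n}"
      using swaps \<sigma> by (auto intro: permutes_compose)
    have less: "disorder n (\<sigma> \<circ> ?ij) < disorder n \<sigma>" "disorder n (\<sigma> \<circ> ?jk) < disorder n \<sigma>"
      "disorder n (\<sigma> \<circ> ?ik) < disorder n \<sigma>"
      using ijk inv by (auto intro!: disorder_swap \<sigma>)
    \<comment> \<open>After one swap, the largest and the smallest of the three values are still inverted and
      occupy the two positions of the next swap.\<close>
    have "disorder n (\<sigma> \<circ> ?ij \<circ> ?jk) < disorder n (\<sigma> \<circ> ?ij)"
      "disorder n (\<sigma> \<circ> ?jk \<circ> ?ij) < disorder n (\<sigma> \<circ> ?jk)"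
      using ijk inv by (auto intro!: disorder_swap perms simp: transpose_def)
    then have less': "disorder n (\<sigma> \<circ> ?ij \<circ> ?jk) < disorder n \<sigma>"
      "disorder n (\<sigma> \<circ> ?jk \<circ> ?ij) < disorder n \<sigma>"
      using less by linarith+
    have IH: "perm_elt \<tau> \<in> R" if "disorder n \<tau> < disorder n \<sigma>" "\<tau> permutes {1..n}" for \<tau>
      using less.hyps[OF that] unfolding R_def by blast
    have "bilin (\<circ>) (perm_elt \<sigma>) (antisym3 i j k) \<in> I"
      by (intro ideal_QS_closed[OF I] ideal_antisym3[OF I E ijk] perm_elt_carrier \<sigma>)
    moreover have "0 \<in> avoiding_span n" by (simp add: avoiding_span_def)
    ultimately have "bilin (\<circ>) (perm_elt \<sigma>) (antisym3 i j k) \<in> R"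
      unfolding R_def by force
    then have "bilin (\<circ>) (perm_elt \<sigma>) (antisym3 i j k) + perm_elt (\<sigma> \<circ> ?jk) + perm_elt (\<sigma> \<circ> ?ij)
        - perm_elt (\<sigma> \<circ> ?ij \<circ> ?jk) - perm_elt (\<sigma> \<circ> ?jk \<circ> ?ij) + perm_elt (\<sigma> \<circ> ?ik) \<in> R"
      by (intro R_add R_diff IH less less' perms)
    moreover have "bilin (\<circ>) (perm_elt \<sigma>) (antisym3 i j k) + perm_elt (\<sigma> \<circ> ?jk) + perm_elt (\<sigma> \<circ> ?ij)
        - perm_elt (\<sigma> \<circ> ?ij \<circ> ?jk) - perm_elt (\<sigma> \<circ> ?jk \<circ> ?ij) + perm_elt (\<sigma> \<circ> ?ik) = perm_elt \<sigma>"
      by (simp add: antisym3_def bilin_diff_right bilin_add_right bilin_perm_elt comp_assoc)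
    ultimately show ?thesis by simp
  qed
  then show ?case unfolding R_def by blast
qed

lemma QS_reduce:
  assumes I: "ideal I (QS n)" and E: "E123 \<in> I" and a: "a \<in> carrier (QS n)"
  shows "\<exists>b\<in>avoiding_span n. a - b \<in> I"
proof -
  have "\<exists>b. b \<in> avoiding_span n \<and> perm_elt \<sigma> - b \<in> I" if "\<sigma> \<in> Poly_Mapping.keys a" for \<sigma>
    using perm_elt_reduce[OF I E] a that unfolding carrier_QS by blast
  then obtain r where r: "\<And>\<sigma>. \<sigma> \<in> Poly_Mapping.keys a \<Longrightarrow> r \<sigma> \<in> avoiding_span n"
    "\<And>\<sigma>. \<sigma> \<in> Poly_Mapping.keys a \<Longrightarrow> perm_elt \<sigma> - r \<sigma> \<in> I"
    by metis
  let ?b = "\<Sum>\<sigma>\<in>Poly_Mapping.keys a. scal (Poly_Mapping.lookup a \<sigma>) (r \<sigma>)"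
  have zero: "0 \<in> avoiding_span n" by (simp add: avoiding_span_def)
  have "(\<Sum>s\<in>S. scal (c s) (r s)) \<in> avoiding_span n" if "S \<subseteq> Poly_Mapping.keys a" for S c
    using finite_subset[OF that finite_keys] that
    by (induction S rule: finite_induct) (simp_all add: zero avoiding_span_closed r)
  then have "?b \<in> avoiding_span n" by blast
  moreover have "a - ?b = (\<Sum>\<sigma>\<in>Poly_Mapping.keys a. scal (Poly_Mapping.lookup a \<sigma>) (perm_elt \<sigma> - r \<sigma>))"
    by (subst (1) QS_expand[of a]) (simp add: scal_diff sum_subtractf)
  then have "a - ?b \<in> I"
    by (simp only:) (intro ideal_QS_sum[OF I] ideal_QS_closed(1)[OF I] r(2))
  ultimately show ?thesis by blast
qed

section \<open>Independence of the 321-avoiding permutations on subsets\<close>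

text \<open>
  The sum of the positive differences \<open>\<tau>(p) - p\<close>: the truncated subtraction drops the negative ones.
\<close>

definition excess :: "nat \<Rightarrow> (nat \<Rightarrow> nat) \<Rightarrow> nat" where
  "excess n \<tau> = (\<Sum>p = 1..n. \<tau> p - p)"

text \<open>
  Suppose \<open>i < j\<close> and \<open>\<tau> i > \<tau> j\<close>. If both are weak exceedances, counting the values above \<open>\<tau> j\<close>
  yields a position after \<open>j\<close> with a value below \<open>\<tau> j\<close>, hence a 321 pattern; in the other case
  there is dually a position before \<open>i\<close> with a value above \<open>\<tau> i\<close>.
\<close>

lemma avoids_321_increasing:
  assumes \<tau>: "\<tau> permutes {1..n}" and av: "avoids_321 n \<tau>"
    and ij: "i \<in> {1..n}" "j \<in> {1..n}" "i < j"
    and side: "i \<le> \<tau> i \<and> j \<le> \<tau> j \<or> \<tau> i \<le> i \<and> \<tau> j \<le> j"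
  shows "\<tau> i < \<tau> j"
proof (rule ccontr)
  assume "\<not> \<tau> i < \<tau> j"
  moreover have "\<tau> i \<noteq> \<tau> j" using permutes_inj[OF \<tau>] ij(3) by (auto dest: injD)
  ultimately have ji: "\<tau> j < \<tau> i" by simp
  have inj: "inj_on \<tau> S" for S using permutes_inj[OF \<tau>] inj_on_subset by blast
  have img: "\<tau> p \<in> {1..n}" if "p \<in> {1..n}" for p using permutes_in_image[OF \<tau>] that by blast
  from side show False
  proof
    assume w: "i \<le> \<tau> i \<and> j \<le> \<tau> j"
    have "\<tau> j < \<tau> k" if "k \<in> {j<..n}" for k
    proof -
      have "\<not> \<tau> k < \<tau> j" using av ij ji that unfolding avoids_321_def by auto
      moreover have "\<tau> k \<noteq> \<tau> j" using permutes_inj[OF \<tau>] that by (auto dest: injD)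
      ultimately show ?thesis by simp
    qed
    then have "\<tau> ` insert i {j<..n} \<subseteq> {\<tau> j<..n}" using ji img ij by auto
    then have "card (insert i {j<..n}) \<le> card {\<tau> j<..n}"
      by (intro card_inj_on_le[OF inj]) auto
    then have "Suc (n - j) \<le> n - \<tau> j" using ij by simp
    then show False using w by linarith
  next
    assume w: "\<tau> i \<le> i \<and> \<tau> j \<le> j"
    have "\<tau> h < \<tau> i" if "h \<in> {1..<i}" for h
    proof -
      have "\<not> \<tau> i < \<tau> h" using av ij ji that unfolding avoids_321_def by auto
      moreover have "\<tau> h \<noteq> \<tau> i" using permutes_inj[OF \<tau>] that by (auto dest: injD)
      ultimately show ?thesis by simp
    qed
    then have "\<tau> ` insert j {1..<i} \<subseteq> {1..<\<tau> i}" using ji img ij by auto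
    then have "card (insert j {1..<i}) \<le> card {1..<\<tau> i}"
      by (intro card_inj_on_le[OF inj]) auto
    then have "i \<le> \<tau> i - 1" using ij by simp
    then show False using w ij(1) by auto
  qed
qed

lemma increasing_eq:
  fixes f g :: "nat \<Rightarrow> nat"
  assumes "finite S" and f: "\<And>i j. i \<in> S \<Longrightarrow> j \<in> S \<Longrightarrow> i < j \<Longrightarrow> f i < f j"
    and g: "\<And>i j. i \<in> S \<Longrightarrow> j \<in> S \<Longrightarrow> i < j \<Longrightarrow> g i < g j"
    and "f ` S = g ` S" "p \<in> S"
  shows "f p = g p"
  using assms
proof (induction S arbitrary: p rule: finite_linorder_max_induct)
  case empty
  then show ?case by simp
next
  case (insert m S)
  have below: "q < m" if "q \<in> S" for q using insert.hyps that by blast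
  have fm: "f q < f m" and gm: "g q < g m" if "q \<in> S" for q
    using below[OF that] that insert.prems(1,2) by blast+
  have "f m = Max (f ` insert m S)" "g m = Max (g ` insert m S)"
    using insert.hyps(1) fm gm by (auto intro!: Max_eqI[symmetric] dest: less_imp_le)
  then have m: "f m = g m" using insert.prems(3) by simp
  have "f m \<notin> f ` S" "g m \<notin> g ` S" using fm gm by (metis imageE less_irrefl)+
  then have S: "f ` S = g ` S"
    using insert.prems(3) m unfolding image_insert by (metis insert_ident)
  show ?case
  proof (cases "p = m")
    case False
    then have "p \<in> S" using insert.prems(4) by simp
    then show ?thesis using insert.IH S insert.prems(1,2) by blast
  qed (use m in simp)
qed

text \<open>
  The unitriangularity behind the independence: \<open>I\<close> and \<open>\<sigma> ` I\<close> determine \<open>\<sigma>\<close> among the 321-avoiding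
  permutations whose excess is not larger.
\<close>

lemma avoids_321_eqI:
  assumes \<sigma>: "\<sigma> permutes {1..n}" "avoids_321 n \<sigma>" and \<tau>: "\<tau> permutes {1..n}" "avoids_321 n \<tau>"
  defines "I \<equiv> {p \<in> {1..n}. p < \<sigma> p}"
  assumes im: "\<tau> ` I = \<sigma> ` I" and le: "excess n \<tau> \<le> excess n \<sigma>"
  shows "\<tau> = \<sigma>"
proof -
  let ?C = "{1..n} - I"
  have I: "I \<subseteq> {1..n}" "finite I" unfolding I_def by auto
  have split: "excess n f = (\<Sum>p\<in>I. f p - p) + (\<Sum>p\<in>?C. f p - p)" for f
    unfolding excess_def by (subst sum.subset_diff[OF I(1)]) simp_all
  have inj: "inj_on \<sigma> S" "inj_on \<tau> S" for S
    using permutes_inj \<sigma>(1) \<tau>(1) inj_on_subset by blast+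
  have "(\<Sum>p\<in>I. \<tau> p) = \<Sum>(\<tau> ` I)" by (simp add: sum.reindex inj)
  also have "\<dots> = (\<Sum>p\<in>I. \<sigma> p)" unfolding im by (simp add: sum.reindex inj)
  also have "\<dots> = (\<Sum>p\<in>I. p + (\<sigma> p - p))" by (rule sum.cong) (auto simp: I_def)
  also have "\<dots> = (\<Sum>p\<in>I. p) + excess n \<sigma>"
  proof -
    have "(\<Sum>p\<in>?C. \<sigma> p - p) = 0" by (auto simp: I_def)
    then show ?thesis by (simp add: split sum.distrib)
  qed
  finally have tot: "(\<Sum>p\<in>I. p) + excess n \<sigma> = (\<Sum>p\<in>I. \<tau> p)" ..
  \<comment> \<open>Bounding the excess of \<open>\<tau>\<close> below by its part on \<open>I\<close> loses nothing, so that \<open>\<tau> p - p\<close> is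
    nowhere truncated on \<open>I\<close> and nowhere positive off \<open>I\<close>.\<close>
  have le': "(\<Sum>p\<in>I. \<tau> p) \<le> (\<Sum>p\<in>I. p + (\<tau> p - p))" by (rule sum_mono) simp
  have "(\<Sum>p\<in>I. p + (\<tau> p - p)) + (\<Sum>p\<in>?C. \<tau> p - p) = (\<Sum>p\<in>I. p) + excess n \<tau>"
    by (simp add: split sum.distrib)
  then have eqs: "(\<Sum>p\<in>I. \<tau> p) = (\<Sum>p\<in>I. p + (\<tau> p - p))" "(\<Sum>p\<in>?C. \<tau> p - p) = 0"
    using le le' tot by linarith+
  have tI: "p \<le> \<tau> p" if "p \<in> I" for p
  proof -
    have "\<tau> p = p + (\<tau> p - p)" by (rule sum_mono_inv[OF eqs(1) _ that I(2)]) simp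
    then show ?thesis by simp
  qed
  have tC: "\<tau> p \<le> p" if "p \<in> ?C" for p using eqs(2) that by auto
  have onI: "\<tau> p = \<sigma> p" if "p \<in> I" for p
    using I(2) _ _ im that
  proof (rule increasing_eq)
    show "\<tau> i < \<tau> j" if "i \<in> I" "j \<in> I" "i < j" for i j
      using avoids_321_increasing[OF \<tau>] that tI I by blast
    show "\<sigma> i < \<sigma> j" if "i \<in> I" "j \<in> I" "i < j" for i j
      using avoids_321_increasing[OF \<sigma>] that by (auto simp: I_def less_imp_le)
  qed
  have onC: "\<tau> p = \<sigma> p" if "p \<in> ?C" for p
  proof (rule increasing_eq[OF _ _ _ _ that])
    show "\<tau> i < \<tau> j" if "i \<in> ?C" "j \<in> ?C" "i < j" for i j
      using avoids_321_increasing[OF \<tau>] that tC by blast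
    show "\<sigma> i < \<sigma> j" if "i \<in> ?C" "j \<in> ?C" "i < j" for i j
      using avoids_321_increasing[OF \<sigma>] that by (auto simp: I_def)
    show "\<tau> ` ?C = \<sigma> ` ?C"
      unfolding image_set_diff[OF permutes_inj[OF \<sigma>(1)]] image_set_diff[OF permutes_inj[OF \<tau>(1)]]
        permutes_image[OF \<sigma>(1)] permutes_image[OF \<tau>(1)] im ..
  qed simp
  show ?thesis
  proof
    fix p show "\<tau> p = \<sigma> p"
      using onI onC permutes_not_in[OF \<sigma>(1)] permutes_not_in[OF \<tau>(1)] by (cases "p \<in> {1..n}") auto
  qed
qed

text \<open>
  The hypothesis says that \<open>b\<close> acts as zero on the subsets of \<open>{1..n}\<close>.
\<close>

lemma avoiding_span_independent:
  assumes b: "b \<in> avoiding_span n"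
    and zero: "\<And>I J. I \<subseteq> {1..n} \<Longrightarrow>
      (\<Sum>\<sigma> | \<sigma> \<in> Poly_Mapping.keys b \<and> \<sigma> ` I = J. Poly_Mapping.lookup b \<sigma>) = 0"
  shows "b = 0"
proof (rule ccontr)
  assume "b \<noteq> 0"
  then have ne: "Poly_Mapping.keys b \<noteq> {}" by simp
  then have "Max (excess n ` Poly_Mapping.keys b) \<in> excess n ` Poly_Mapping.keys b"
    by (intro Max_in) simp_all
  then obtain \<sigma> where \<sigma>: "\<sigma> \<in> Poly_Mapping.keys b"
    and \<sigma>_max: "excess n \<sigma> = Max (excess n ` Poly_Mapping.keys b)" by auto
  have max: "excess n \<tau> \<le> excess n \<sigma>" if "\<tau> \<in> Poly_Mapping.keys b" for \<tau>
    unfolding \<sigma>_max using that by (intro Max_ge) simp_all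
  let ?I = "{p \<in> {1..n}. p < \<sigma> p}"
  have "{\<tau>. \<tau> \<in> Poly_Mapping.keys b \<and> \<tau> ` ?I = \<sigma> ` ?I} = {\<sigma>}"
  proof -
    have "\<tau> = \<sigma>" if "\<tau> \<in> Poly_Mapping.keys b" "\<tau> ` ?I = \<sigma> ` ?I" for \<tau>
      by (rule avoids_321_eqI[OF _ _ _ _ that(2) max[OF that(1)]])
        (use b \<sigma> that(1) in \<open>auto simp: avoiding_span_def\<close>)
    then show ?thesis using \<sigma> by blast
  qed
  then have "Poly_Mapping.lookup b \<sigma> = 0"
    using zero[OF Collect_restrict, of "\<lambda>p. p < \<sigma> p" "\<sigma> ` ?I"] by (simp del: atLeastAtMost_iff)
  then show False using \<sigma> by (simp add: in_keys_iff)
qed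

section \<open>The kernel of the Hivert action\<close>

lemma hivert_monomial:
  "hivert a (Poly_Mapping.single m 1)
    = (\<Sum>\<sigma>\<in>Poly_Mapping.keys a. Poly_Mapping.single (hivert_mono \<sigma> m) (Poly_Mapping.lookup a \<sigma>))"
  unfolding hivert_def by (subst bilin_superset[of "Poly_Mapping.keys a" "{m}"]) auto

lemma Ker_subset_sum:
  assumes a: "a \<in> Ker n" and I: "I \<subseteq> {1..n}"
  shows "(\<Sum>\<sigma> | \<sigma> \<in> Poly_Mapping.keys a \<and> \<sigma> ` I = J. Poly_Mapping.lookup a \<sigma>) = 0"
proof (cases "\<exists>\<sigma>\<in>Poly_Mapping.keys a. \<sigma> ` I = J")
  case True
  have fin: "finite I" using I finite_subset by blast
  have perm: "\<sigma> permutes {1..n}" if "\<sigma> \<in> Poly_Mapping.keys a" for \<sigma>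
    using a that unfolding Ker_def action_kernel_def carrier_QS by blast
  have card: "card (\<sigma> ` I) = card I" if "\<sigma> \<in> Poly_Mapping.keys a" for \<sigma>
    by (rule card_image) (use permutes_inj[OF perm[OF that]] inj_on_subset in blast)
  \<comment> \<open>The squarefree monomials in the \<open>x\<close> variables realize the action on subsets.\<close>
  define \<aa> where "\<aa> = replicate (card I) (1::nat, 0::nat)"
  have \<aa>: "bicomposition \<aa>" "length \<aa> = card I" by (auto simp: \<aa>_def bicomposition_def)
  have J: "finite J" "card J = card I" using True fin card by auto
  let ?m = "xy I \<aa>"
  have eq: "hivert_mono \<sigma> ?m = xy J \<aa> \<longleftrightarrow> \<sigma> ` I = J" if "\<sigma> \<in> Poly_Mapping.keys a" for \<sigma>
    using mono_set_xy[of J \<aa>] mono_set_xy[of "\<sigma> ` I" \<aa>] \<aa> fin J card[OF that]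
    by (auto simp: hivert_mono_xy[OF fin \<aa>])
  have "Poly_Mapping.single ?m 1 \<in> polys n"
    using I by (simp add: polys_iff mono_set_xy[OF fin \<aa>])
  then have "hivert a (Poly_Mapping.single ?m 1) = 0"
    using a unfolding Ker_def action_kernel_def by blast
  then have "0 = Poly_Mapping.lookup (hivert a (Poly_Mapping.single ?m 1)) (xy J \<aa>)" by simp
  also have "\<dots> = (\<Sum>\<sigma>\<in>Poly_Mapping.keys a. if \<sigma> ` I = J then Poly_Mapping.lookup a \<sigma> else 0)"
    unfolding hivert_monomial lookup_sum
    by (intro sum.cong) (auto simp: lookup_single when_def eq)
  also have "\<dots> = (\<Sum>\<sigma> | \<sigma> \<in> Poly_Mapping.keys a \<and> \<sigma> ` I = J. Poly_Mapping.lookup a \<sigma>)"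
    by (rule sum.inter_filter[symmetric]) simp
  finally show ?thesis by simp
next
  case False
  then show ?thesis by (intro sum.neutral) auto
qed

lemma KerI:
  assumes a: "a \<in> carrier (QS n)"
    and zero: "\<And>m. mono_set m \<subseteq> {1..n} \<Longrightarrow> hivert a (Poly_Mapping.single m 1) = 0"
  shows "a \<in> Ker n"
proof -
  have "hivert a f = 0" if "f \<in> polys n" for f
  proof -
    have "f = (\<Sum>m\<in>Poly_Mapping.keys f. scal (Poly_Mapping.lookup f m) (Poly_Mapping.single m 1))"
      by (simp add: scal_single sum_single)
    then have "hivert a f = (\<Sum>m\<in>Poly_Mapping.keys f.
        scal (Poly_Mapping.lookup f m) (hivert a (Poly_Mapping.single m 1)))"
      unfolding hivert_def by (metis (no_types, lifting) bilin_scal_right bilin_sum_right sum.cong)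
    also have "\<dots> = 0"
      using that by (intro sum.neutral ballI poly_mapping_eqI) (simp add: zero polys_iff)
    finally show ?thesis .
  qed
  then show ?thesis using a by (simp add: Ker_def action_kernel_def)
qed

lemma E123_in_Ker:
  assumes "3 \<le> n"
  shows "E123 \<in> Ker n"
proof (rule KerI)
  show "E123 \<in> carrier (QS n)"
    unfolding E123_eq_antisym3 using assms by (intro antisym3_carrier) auto
  fix m
  let ?I = "mono_set m"
  let ?M = "\<lambda>\<sigma>. Poly_Mapping.single (hivert_mono \<sigma> m) (1::rat)"
  let ?ij = "transpose 1 2 :: nat \<Rightarrow> nat" and ?jk = "transpose 2 3 :: nat \<Rightarrow> nat"
    and ?ik = "transpose 1 3 :: nat \<Rightarrow> nat"
  have M: "hivert (perm_elt \<sigma>) (Poly_Mapping.single m 1) = ?M \<sigma>" for \<sigma>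
    by (simp add: hivert_def perm_elt_def bilin_single)
  have expand: "hivert E123 (Poly_Mapping.single m 1)
      = ?M id - ?M ?jk - ?M ?ij + ?M (?ij \<circ> ?jk) + ?M (?jk \<circ> ?ij) - ?M ?ik"
    unfolding E123_eq_antisym3 antisym3_def M[symmetric]
    by (simp add: hivert_def bilin_diff_left bilin_add_left)
  have eq: "?M (\<sigma> \<circ> transpose a b) = ?M \<sigma>" if "a \<in> ?I \<longleftrightarrow> b \<in> ?I" for \<sigma> a b
    using that unfolding hivert_mono_def image_comp[symmetric] by simp
  have words: "?ij \<circ> ?jk = ?ik \<circ> ?ij" "?jk \<circ> ?ij = ?ik \<circ> ?jk" "?ij \<circ> ?jk = ?jk \<circ> ?ik"
    "?jk \<circ> ?ij = ?ij \<circ> ?ik"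
    by (auto simp: fun_eq_iff transpose_def)
  \<comment> \<open>Two of the three points agree on membership in \<open>?I\<close>; composing with their transposition pairs
    each permutation with one of opposite sign.\<close>
  consider "1 \<in> ?I \<longleftrightarrow> 2 \<in> ?I" | "2 \<in> ?I \<longleftrightarrow> 3 \<in> ?I" | "1 \<in> ?I \<longleftrightarrow> 3 \<in> ?I" by blast
  then show "hivert E123 (Poly_Mapping.single m 1) = 0"
  proof cases
    case 1
    have "?M ?ij = ?M id" "?M (?ij \<circ> ?jk) = ?M ?ik" "?M (?jk \<circ> ?ij) = ?M ?jk"
      using eq[OF 1, of id] eq[OF 1, of ?ik] eq[OF 1, of ?jk] unfolding words(1) by simp_all
    then show ?thesis unfolding expand by simp
  next
    case 2
    have "?M ?jk = ?M id" "?M (?ij \<circ> ?jk) = ?M ?ij" "?M (?jk \<circ> ?ij) = ?M ?ik"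
      using eq[OF 2, of id] eq[OF 2, of ?ij] eq[OF 2, of ?ik] unfolding words(2) by simp_all
    then show ?thesis unfolding expand by simp
  next
    case 3
    have "?M ?ik = ?M id" "?M (?ij \<circ> ?jk) = ?M ?jk" "?M (?jk \<circ> ?ij) = ?M ?ij"
      using eq[OF 3, of id] eq[OF 3, of ?jk] eq[OF 3, of ?ij] unfolding words(3,4) by simp_all
    then show ?thesis unfolding expand by simp
  qed
qed

lemma ideal_Ker: "ideal (Ker n) (QS n)"
  unfolding Ker_def by (rule ideal_action_kernel[OF ring_QS algebra_action_hivert])

lemma Ker_subset_ideal:
  assumes I: "ideal I (QS n)" and E: "E123 \<in> I" and sub: "I \<subseteq> Ker n"
  shows "Ker n \<subseteq> I"
proof
  fix a assume a: "a \<in> Ker n"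
  then have "a \<in> carrier (QS n)" by (simp add: Ker_def action_kernel_def)
  then obtain b where b: "b \<in> avoiding_span n" "a - b \<in> I" using QS_reduce[OF I E] by blast
  have "a - (a - b) \<in> Ker n" using ideal_QS_closed(3)[OF ideal_Ker a] b(2) sub by blast
  then have "b \<in> Ker n" by simp
  then have "b = 0" using avoiding_span_independent[OF b(1)] Ker_subset_sum by blast
  then show "a \<in> I" using b(2) by simp
qed

lemma Ker_eq_Idl:
  assumes "3 \<le> n"
  shows "Ker n = Idl\<^bsub>QS n\<^esub> {E123}"
proof -
  interpret ring "QS n" by (rule ring_QS)
  have E: "{E123} \<subseteq> carrier (QS n)"
    using E123_in_Ker[OF assms] by (simp add: Ker_def action_kernel_def)
  have "Idl\<^bsub>QS n\<^esub> {E123} \<subseteq> Ker n"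
    using genideal_minimal[OF ideal_Ker] E123_in_Ker[OF assms] by simp
  then show ?thesis
    using Ker_subset_ideal[OF genideal_ideal[OF E]] genideal_self[OF E] by blast
qed

lemma polys_closed:
  "f \<in> polys n \<Longrightarrow> g \<in> polys n \<Longrightarrow> f + g \<in> polys n" "f \<in> polys n \<Longrightarrow> scal c f \<in> polys n"
  using Poly_Mapping.keys_add[of f g] keys_scal[of c f] unfolding polys_iff by blast+

theorem proposition2p1:
  fixes n :: nat
  assumes "3 \<le> n"
  shows "Ker n = Idl\<^bsub>QS n\<^esub> {E123}
    \<and> (\<exists>\<phi> \<in> algebra_iso (TL n) (quot_algebra (QS n) (Ker n)).
         \<forall>a\<in>carrier (QS n). \<phi> (TL_ideal n +>\<^bsub>QS n\<^esub> a) = Ker n +>\<^bsub>QS n\<^esub> a)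
    \<and> (\<exists>\<rho>. faithful_action (TL n) (polys n) \<rho>
         \<and> (\<forall>a\<in>carrier (QS n). \<forall>f\<in>polys n. \<rho> (TL_ideal n +>\<^bsub>QS n\<^esub> a) f = hivert a f))"
proof -
  have ker: "Ker n = Idl\<^bsub>QS n\<^esub> {E123}" by (rule Ker_eq_Idl[OF assms])
  then have TL: "TL_ideal n = Ker n" using TL_ideal_eq[OF assms] by simp
  have "id \<in> algebra_iso (TL n) (quot_algebra (QS n) (Ker n))"
    unfolding TL_def TL algebra_iso_def by (simp add: ring_iso_def ring_hom_def)
  moreover have "\<exists>\<rho>. faithful_action (TL n) (polys n) \<rho>
      \<and> (\<forall>a\<in>carrier (QS n). \<forall>f\<in>polys n. \<rho> (TL_ideal n +>\<^bsub>QS n\<^esub> a) f = hivert a f)"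
    unfolding TL_def TL Ker_def
    by (intro faithful_quotient_action[OF ring_QS algebra_action_hivert] polys_closed)
      (simp_all add: QS_simps QS_carrier_scal)
  ultimately show ?thesis using ker TL by (intro conjI bexI[of _ id]) auto
qed

end
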